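(* Let $P(\lambda)=I\lambda^m+A_{m-1}\lambda^{m-1}+\cdots+A_1\lambda+A_0$ be an $n\times n$ quaternion matrix polynomial of degree $m$ with leading coefficient the identity matrix $I$ and $A_0,\dots,A_{m-1}\in M_n(\mathbb{H})$, and let $\Omega\subseteq\mathbb{H}$ be nonempty. If $P(\lambda)$ is an upper-triangular matrix polynomial, then $P(\lambda)$ is hyperstable with respect to $\Omega$ if and only if it is stable with respect to $\Omega$.
   Context: $\mathbb{H}$ denotes the real quaternions, $M_n(\mathbb{H})$ the set of $n\times n$ quaternion matrices, $\mathbb{H}^n$ the space of quaternion column vectors, and $z^*$ the conjugate transpose. $P(\lambda)=\sum_{i=0}^m A_i\lambda^i$ is upper-triangular if all its coefficient matrices $A_i$ are upper triangular. $P(\lambda)$ is stable with respect to $\Omega$ if for every nonzero $y\in\mathbb{H}^n$ and every $\mu\in\Omega$ there is a nonzero $z\in\mathbb{H}^n$ with $\sum_{i=0}^m z^*A_i y\mu^i\neq 0$ (here $A_m=I$). It is hyperstable with respect to $\Omega$ if for every nonzero $y\in\mathbb{H}^n$ there is a nonzero $z\in\mathbb{H}^n$ with $\sum_{i=0}^m z^*A_i y\mu^i\neq0$ for all $\mu\in\Omega$. *)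

theory Defs
  imports Complex_Main "Jordan_Normal_Form.Matrix"
begin

section \<open>The real quaternions\<close>

text \<open>\<open>Quat a b c d\<close> is the quaternion \<open>a + b i + c j + d k\<close>, with
  \<open>i\<^sup>2 = j\<^sup>2 = k\<^sup>2 = i j k = -1\<close>.\<close>

datatype quat = Quat (qRe: real) (qIm1: real) (qIm2: real) (qIm3: real)

lemma quat_eq_iff:
  "x = y \<longleftrightarrow> qRe x = qRe y \<and> qIm1 x = qIm1 y \<and> qIm2 x = qIm2 y \<and> qIm3 x = qIm3 y"
  by (cases x; cases y) simp

instantiation quat :: real_vector
begin

definition "0 = Quat 0 0 0 0"
definition "x + y = Quat (qRe x + qRe y) (qIm1 x + qIm1 y) (qIm2 x + qIm2 y) (qIm3 x + qIm3 y)"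
definition "- x = Quat (- qRe x) (- qIm1 x) (- qIm2 x) (- qIm3 x)"
definition "x - y = Quat (qRe x - qRe y) (qIm1 x - qIm1 y) (qIm2 x - qIm2 y) (qIm3 x - qIm3 y)"
definition "r *\<^sub>R x = Quat (r * qRe x) (r * qIm1 x) (r * qIm2 x) (r * qIm3 x)"

instance
  by standard
    (simp_all add: zero_quat_def plus_quat_def uminus_quat_def minus_quat_def
      scaleR_quat_def quat_eq_iff algebra_simps)

end

lemma quat_additive_sel [simp]:
  "qRe 0 = 0" "qIm1 0 = 0" "qIm2 0 = 0" "qIm3 0 = 0"
  "qRe (x + y) = qRe x + qRe y" "qIm1 (x + y) = qIm1 x + qIm1 y"
  "qIm2 (x + y) = qIm2 x + qIm2 y" "qIm3 (x + y) = qIm3 x + qIm3 y"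
  "qRe (- x) = - qRe x" "qIm1 (- x) = - qIm1 x"
  "qIm2 (- x) = - qIm2 x" "qIm3 (- x) = - qIm3 x"
  "qRe (x - y) = qRe x - qRe y" "qIm1 (x - y) = qIm1 x - qIm1 y"
  "qIm2 (x - y) = qIm2 x - qIm2 y" "qIm3 (x - y) = qIm3 x - qIm3 y"
  "qRe (r *\<^sub>R x) = r * qRe x" "qIm1 (r *\<^sub>R x) = r * qIm1 x"
  "qIm2 (r *\<^sub>R x) = r * qIm2 x" "qIm3 (r *\<^sub>R x) = r * qIm3 x"
  by (simp_all add: zero_quat_def plus_quat_def uminus_quat_def minus_quat_def scaleR_quat_def)

definition qcnj :: "quat \<Rightarrow> quat" where
  "qcnj x = Quat (qRe x) (- qIm1 x) (- qIm2 x) (- qIm3 x)"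

definition qnorm2 :: "quat \<Rightarrow> real" where
  "qnorm2 x = (qRe x)\<^sup>2 + (qIm1 x)\<^sup>2 + (qIm2 x)\<^sup>2 + (qIm3 x)\<^sup>2"

lemma qcnj_sel [simp]:
  "qRe (qcnj x) = qRe x" "qIm1 (qcnj x) = - qIm1 x"
  "qIm2 (qcnj x) = - qIm2 x" "qIm3 (qcnj x) = - qIm3 x"
  by (simp_all add: qcnj_def)

lemma qnorm2_eq_0_iff: "qnorm2 x = 0 \<longleftrightarrow> x = 0"
  by (simp add: qnorm2_def quat_eq_iff add_nonneg_eq_0_iff)

instantiation quat :: real_div_algebra
begin

definition "1 = Quat 1 0 0 0"

definition
  "x * y = Quat
    (qRe x * qRe y - qIm1 x * qIm1 y - qIm2 x * qIm2 y - qIm3 x * qIm3 y)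
    (qRe x * qIm1 y + qIm1 x * qRe y + qIm2 x * qIm3 y - qIm3 x * qIm2 y)
    (qRe x * qIm2 y - qIm1 x * qIm3 y + qIm2 x * qRe y + qIm3 x * qIm1 y)
    (qRe x * qIm3 y + qIm1 x * qIm2 y - qIm2 x * qIm1 y + qIm3 x * qRe y)"

definition "inverse x = (1 / qnorm2 x) *\<^sub>R qcnj x"

definition "x div y = x * inverse y" for x y :: quat

instance
proof
  fix x y z :: quat and r :: real
  show "x * y * z = x * (y * z)" "1 * x = x" "x * 1 = x"
    "(x + y) * z = x * z + y * z" "x * (y + z) = x * y + x * z"
    "(r *\<^sub>R x) * y = r *\<^sub>R (x * y)" "x * (r *\<^sub>R y) = r *\<^sub>R (x * y)"
    by (simp_all add: one_quat_def times_quat_def quat_eq_iff algebra_simps)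
  show "(0::quat) \<noteq> 1"
    by (simp add: one_quat_def quat_eq_iff)
  show "inverse (0::quat) = 0"
    by (simp add: inverse_quat_def quat_eq_iff)
  show "x div y = x * inverse y"
    by (rule divide_quat_def)
  assume "x \<noteq> 0"
  then have nz: "qnorm2 x \<noteq> 0"
    by (simp add: qnorm2_eq_0_iff)
  show "inverse x * x = 1" "x * inverse x = 1"
    using nz
    by (simp_all add: inverse_quat_def one_quat_def times_quat_def quat_eq_iff divide_simps)
      (simp_all add: qnorm2_def algebra_simps power2_eq_square)
qed

end

lemma quat_mult_sel [simp]:
  "qRe 1 = 1" "qIm1 1 = 0" "qIm2 1 = 0" "qIm3 1 = 0"
  "qRe (x * y) = qRe x * qRe y - qIm1 x * qIm1 y - qIm2 x * qIm2 y - qIm3 x * qIm3 y"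
  "qIm1 (x * y) = qRe x * qIm1 y + qIm1 x * qRe y + qIm2 x * qIm3 y - qIm3 x * qIm2 y"
  "qIm2 (x * y) = qRe x * qIm2 y - qIm1 x * qIm3 y + qIm2 x * qRe y + qIm3 x * qIm1 y"
  "qIm3 (x * y) = qRe x * qIm3 y + qIm1 x * qIm2 y - qIm2 x * qIm1 y + qIm3 x * qRe y"
  by (simp_all add: one_quat_def times_quat_def)

lemma quat_units:
  "Quat 0 1 0 0 * Quat 0 1 0 0 = - 1" "Quat 0 0 1 0 * Quat 0 0 1 0 = - 1"
  "Quat 0 0 0 1 * Quat 0 0 0 1 = - 1" "Quat 0 1 0 0 * Quat 0 0 1 0 * Quat 0 0 0 1 = - 1"
  by (simp_all add: quat_eq_iff)

lemma qcnj_mult: "qcnj (x * y) = qcnj y * qcnj x"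
  by (simp add: quat_eq_iff algebra_simps)

section \<open>Quaternion matrix polynomials\<close>

text \<open>A matrix polynomial \<open>P(\<lambda>) = A\<^sub>m \<lambda>\<^sup>m + \<dots> + A\<^sub>1 \<lambda> + A\<^sub>0\<close> of size \<open>n\<close> is given by
  \<open>n\<close>, \<open>m\<close> and the coefficient family \<open>A\<close>; only \<open>A 0, \<dots>, A m\<close> are relevant.\<close>

definition upper_triangular_poly :: "nat \<Rightarrow> (nat \<Rightarrow> quat mat) \<Rightarrow> bool" where
  "upper_triangular_poly m A \<longleftrightarrow> (\<forall>i\<le>m. upper_triangular (A i))"

text \<open>The scalar \<open>z\<^sup>* B y\<close>. The library's sesquilinear \<open>\<bullet>c\<close> is not used:
  it conjugates the right factor and needs a multiplicative conjugation, whereas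
  quaternion conjugation reverses products.\<close>

definition qform :: "quat vec \<Rightarrow> quat mat \<Rightarrow> quat vec \<Rightarrow> quat" where
  "qform z B y = map_vec qcnj z \<bullet> (B *\<^sub>v y)"

definition stable_poly :: "nat \<Rightarrow> nat \<Rightarrow> (nat \<Rightarrow> quat mat) \<Rightarrow> quat set \<Rightarrow> bool" where
  "stable_poly n m A \<Omega> \<longleftrightarrow>
    (\<forall>y \<in> carrier_vec n. y \<noteq> 0\<^sub>v n \<longrightarrow>
      (\<forall>\<mu>\<in>\<Omega>. \<exists>z \<in> carrier_vec n. z \<noteq> 0\<^sub>v n \<and>
        (\<Sum>i\<le>m. qform z (A i) y * \<mu> ^ i) \<noteq> 0))"

definition hyperstable_poly :: "nat \<Rightarrow> nat \<Rightarrow> (nat \<Rightarrow> quat mat) \<Rightarrow> quat set \<Rightarrow> bool" where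
  "hyperstable_poly n m A \<Omega> \<longleftrightarrow>
    (\<forall>y \<in> carrier_vec n. y \<noteq> 0\<^sub>v n \<longrightarrow>
      (\<exists>z \<in> carrier_vec n. z \<noteq> 0\<^sub>v n \<and>
        (\<forall>\<mu>\<in>\<Omega>. (\<Sum>i\<le>m. qform z (A i) y * \<mu> ^ i) \<noteq> 0)))"

end

theory Submission
  imports Defs
begin

text \<open>Hyperstability implies stability because the same \<open>z\<close> serves every \<open>\<mu>\<close>. For the converse, fix
  \<open>\<mu> \<in> \<Omega>\<close> and let \<open>\<Lambda>\<^sub>j\<^sub>l\<close> be the real-linear map \<open>x \<mapsto> \<Sum>\<^sub>i (A\<^sub>i)\<^sub>j\<^sub>l x \<mu>\<^sup>i\<close> on the quaternions, so that
  row \<open>j\<close> of \<open>\<Sum>\<^sub>i A\<^sub>i y \<mu>\<^sup>i\<close> is \<open>\<Sum>\<^sub>l \<Lambda>\<^sub>j\<^sub>l y\<^sub>l\<close>.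

  Stability forces every diagonal map \<open>\<Lambda>\<^sub>k\<^sub>k\<close> to be injective. Otherwise take the least \<open>k\<close> for which
  \<open>\<Lambda>\<^sub>k\<^sub>k q = 0\<close> with some \<open>q \<noteq> 0\<close>. For \<open>j < k\<close> the map \<open>\<Lambda>\<^sub>j\<^sub>j\<close> is injective, hence surjective since the
  quaternions have finite real dimension, and back substitution starting from \<open>y\<^sub>k = q\<close> gives a
  nonzero \<open>y\<close> with \<open>\<Sum>\<^sub>i A\<^sub>i y \<mu>\<^sup>i = 0\<close>, so that no \<open>z\<close> is suitable for \<open>y\<close> and \<open>\<mu>\<close>.

  Given now \<open>y \<noteq> 0\<close>, let \<open>k\<close> be its last nonzero position. Row \<open>k\<close> of \<open>\<Sum>\<^sub>i A\<^sub>i y \<mu>\<^sup>i\<close> is \<open>\<Lambda>\<^sub>k\<^sub>k y\<^sub>k \<noteq> 0\<close>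
  for every \<open>\<mu> \<in> \<Omega>\<close>, so the unit vector \<open>z = e\<^sub>k\<close>, which depends on \<open>y\<close> only, shows
  hyperstability.\<close>

lemma quat_linear_inj_imp_surj:
  fixes f :: "quat \<Rightarrow> quat"
  assumes "linear f" "\<And>x. f x = 0 \<Longrightarrow> x = 0"
  shows "surj f"
proof -
  let ?B = "{Quat 1 0 0 0, Quat 0 1 0 0, Quat 0 0 1 0, Quat 0 0 0 1}"
  have "independent ?B"
    by (simp add: dependent_finite quat_eq_iff)
  moreover have "x \<in> span ?B" for x
  proof -
    have "x = qRe x *\<^sub>R Quat 1 0 0 0 + qIm1 x *\<^sub>R Quat 0 1 0 0
        + qIm2 x *\<^sub>R Quat 0 0 1 0 + qIm3 x *\<^sub>R Quat 0 0 0 1"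
      by (simp add: quat_eq_iff)
    also have "\<dots> \<in> span ?B"
      by (intro span_add span_scale span_base) auto
    finally show ?thesis .
  qed
  ultimately interpret finite_dimensional_vector_space "scaleR :: real \<Rightarrow> quat \<Rightarrow> quat" ?B
    by unfold_locales (auto simp: dependent_raw_def span_raw_def scaleR_add_right scaleR_add_left)
  have "inj f"
    using assms linear_injective_0 by blast
  then show ?thesis
    using assms(1) linear_inj_imp_surj by (simp add: linear_def)
qed

text \<open>The entries \<open>y j\<close> are chosen in order of decreasing \<open>j\<close>: row \<open>j\<close> prescribes the value of
  \<open>L j j (y j)\<close> in terms of the entries of larger index, so only surjectivity of the diagonal maps
  is needed.\<close>

lemma back_substitution:
  fixes L :: "nat \<Rightarrow> nat \<Rightarrow> 'a::ab_group_add \<Rightarrow> 'a"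
  assumes "\<And>j. j < k \<Longrightarrow> surj (L j j)"
  obtains y where "y k = q" "\<And>j. j < k \<Longrightarrow> (\<Sum>l=j..k. L j l (y l)) = 0"
proof -
  have "\<exists>y. y k = q \<and> (\<forall>j\<in>{0..<k}. (\<Sum>l=j..k. L j l (y l)) = 0)"
  proof (rule inc_induct[of 0 k])
    show "\<exists>y. y k = q \<and> (\<forall>j\<in>{k..<k}. (\<Sum>l=j..k. L j l (y l)) = 0)"
      by auto
  next
    fix p
    assume "p < k"
      and "\<exists>y. y k = q \<and> (\<forall>j\<in>{Suc p..<k}. (\<Sum>l=j..k. L j l (y l)) = 0)"
    then obtain y where y: "y k = q" "\<And>j. Suc p \<le> j \<Longrightarrow> j < k \<Longrightarrow> (\<Sum>l=j..k. L j l (y l)) = 0"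
      by auto
    obtain x where x: "L p p x = - (\<Sum>l=Suc p..k. L p l (y l))"
      using assms[OF \<open>p < k\<close>] by (metis surjD)
    have same: "(\<Sum>l=j..k. L i l ((y(p := x)) l)) = (\<Sum>l=j..k. L i l (y l))" if "Suc p \<le> j" for i j
      using that by (intro sum.cong) auto
    have "(\<Sum>l=j..k. L j l ((y(p := x)) l)) = 0" if "p \<le> j" "j < k" for j
    proof (cases "j = p")
      case True
      then show ?thesis
        using \<open>p < k\<close> x same[of "Suc p" p] by (simp add: sum.atLeast_Suc_atMost del: fun_upd_apply) simp
    next
      case False
      then show ?thesis
        using that y(2) same[of j j] by (simp del: fun_upd_apply)
    qed
    then show "\<exists>y. y k = q \<and> (\<forall>j\<in>{p..<k}. (\<Sum>l=j..k. L j l (y l)) = 0)"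
      using y(1) \<open>p < k\<close> by (intro exI[of _ "y(p := x)"]) auto
  qed simp
  then show ?thesis
    using that by auto
qed

text \<open>The map \<open>\<Lambda>\<^sub>j\<^sub>l\<close>: the \<open>(j, l)\<close> entry of the matrix polynomial, acting on a quaternion \<open>x\<close> with the
  powers of \<open>\<mu>\<close> placed to the right of \<open>x\<close>.\<close>

definition entry_map :: "nat \<Rightarrow> (nat \<Rightarrow> quat mat) \<Rightarrow> quat \<Rightarrow> nat \<Rightarrow> nat \<Rightarrow> quat \<Rightarrow> quat" where
  "entry_map m A \<mu> j l x = (\<Sum>i\<le>m. A i $$ (j, l) * x * \<mu> ^ i)"

lemma linear_entry_map: "linear (entry_map m A \<mu> j l)"
  by (rule linearI)
    (simp_all add: entry_map_def algebra_simps sum.distrib scaleR_sum_right)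

lemma entry_map_0 [simp]: "entry_map m A \<mu> j l 0 = 0"
  by (simp add: entry_map_def)

lemma sum_qform_eq_entry_maps:
  assumes "\<And>i. i \<le> m \<Longrightarrow> A i \<in> carrier_mat n n" "y \<in> carrier_vec n" "z \<in> carrier_vec n"
  shows "(\<Sum>i\<le>m. qform z (A i) y * \<mu> ^ i)
    = (\<Sum>j<n. qcnj (z $ j) * (\<Sum>l<n. entry_map m A \<mu> j l (y $ l)))"
proof -
  have "qform z (A i) y * \<mu> ^ i
      = (\<Sum>j<n. \<Sum>l<n. qcnj (z $ j) * (A i $$ (j, l) * y $ l * \<mu> ^ i))" if "i \<le> m" for i
    using assms(1)[OF that] assms(2,3)
    by (simp add: qform_def scalar_prod_def atLeast0LessThan sum_distrib_left sum_distrib_right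
        mult.assoc)
  then have "(\<Sum>i\<le>m. qform z (A i) y * \<mu> ^ i)
      = (\<Sum>i\<le>m. \<Sum>j<n. \<Sum>l<n. qcnj (z $ j) * (A i $$ (j, l) * y $ l * \<mu> ^ i))"
    by simp
  also have "\<dots> = (\<Sum>j<n. \<Sum>l<n. \<Sum>i\<le>m. qcnj (z $ j) * (A i $$ (j, l) * y $ l * \<mu> ^ i))"
    by (subst sum.swap, rule sum.cong[OF refl], rule sum.swap)
  finally show ?thesis
    by (simp add: entry_map_def sum_distrib_left)
qed

lemma upper_triangular_row_sum:
  assumes "\<And>i. i \<le> m \<Longrightarrow> A i \<in> carrier_mat n n" "upper_triangular_poly m A"
    and "j < n" "k < n" "\<And>l. k < l \<Longrightarrow> l < n \<Longrightarrow> y l = 0"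
  shows "(\<Sum>l<n. entry_map m A \<mu> j l (y l)) = (\<Sum>l=j..k. entry_map m A \<mu> j l (y l))"
proof (rule sum.mono_neutral_right)
  have "entry_map m A \<mu> j l x = 0" if "l < j" for l x
  proof -
    have "A i $$ (j, l) = 0" if "i \<le> m" for i
      using assms(1)[OF that] assms(2,3) that \<open>l < j\<close>
        upper_triangularD[of "A i" l j] by (simp add: upper_triangular_poly_def)
    then show ?thesis
      by (simp add: entry_map_def)
  qed
  then show "\<forall>l\<in>{..<n} - {j..k}. entry_map m A \<mu> j l (y l) = 0"
    using assms(5) by (metis DiffE atLeastAtMost_iff entry_map_0 lessThan_iff not_le)
qed (use assms(4) in auto)

lemma stable_imp_diagonal_injective:
  assumes A: "\<And>i. i \<le> m \<Longrightarrow> A i \<in> carrier_mat n n" "upper_triangular_poly m A"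
    and "stable_poly n m A \<Omega>" "\<mu> \<in> \<Omega>"
  shows "k < n \<Longrightarrow> entry_map m A \<mu> k k q = 0 \<Longrightarrow> q = 0"
proof (induction k arbitrary: q rule: less_induct)
  case (less k)
  show ?case
  proof (rule ccontr)
    assume "q \<noteq> 0"
    have "surj (entry_map m A \<mu> j j)" if "j < k" for j
      using less.IH[OF that] that less.prems(1) linear_entry_map
      by (intro quat_linear_inj_imp_surj) auto
    then obtain f where f: "f k = q" "\<And>j. j < k \<Longrightarrow> (\<Sum>l=j..k. entry_map m A \<mu> j l (f l)) = 0"
      using back_substitution[of k "entry_map m A \<mu>" q] by metis
    define y where "y = vec n (\<lambda>l. if l \<le> k then f l else 0)"
    have y: "y \<in> carrier_vec n"
      by (simp add: y_def)
    have "y $ k \<noteq> 0"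
      using less.prems(1) f(1) \<open>q \<noteq> 0\<close> by (simp add: y_def)
    then have "y \<noteq> 0\<^sub>v n"
      using less.prems(1) by auto
    then obtain z where z: "z \<in> carrier_vec n" "(\<Sum>i\<le>m. qform z (A i) y * \<mu> ^ i) \<noteq> 0"
      using assms(3,4) y unfolding stable_poly_def by blast
    have "(\<Sum>l<n. entry_map m A \<mu> j l (y $ l)) = 0" if "j < n" for j
    proof -
      have "(\<Sum>l<n. entry_map m A \<mu> j l (y $ l)) = (\<Sum>l=j..k. entry_map m A \<mu> j l (y $ l))"
        using that less.prems(1)
        by (intro upper_triangular_row_sum[OF A]) (auto simp: y_def)
      also have "\<dots> = (\<Sum>l=j..k. entry_map m A \<mu> j l (f l))"
        using less.prems(1) by (intro sum.cong) (auto simp: y_def)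
      also have "\<dots> = 0"
        using f less.prems(2) by (cases j k rule: linorder_cases) auto
      finally show ?thesis .
    qed
    then show False
      using z sum_qform_eq_entry_maps[OF A(1) y z(1)] by simp
  qed
qed

lemma last_nonzero_index:
  assumes "y \<in> carrier_vec n" "y \<noteq> 0\<^sub>v n"
  obtains k where "k < n" "y $ k \<noteq> 0" "\<And>l. k < l \<Longrightarrow> l < n \<Longrightarrow> y $ l = 0"
proof -
  let ?S = "{l. l < n \<and> y $ l \<noteq> 0}"
  have "?S \<noteq> {}"
    using assms by auto
  then have "Max ?S \<in> ?S"
    by (intro Max_in) auto
  moreover have "y $ l = 0" if "Max ?S < l" "l < n" for l
    using that Max_ge[of ?S l] by fastforce
  ultimately show ?thesis
    using that by blast
qed

lemma stable_imp_hyperstable: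
  assumes A: "\<And>i. i \<le> m \<Longrightarrow> A i \<in> carrier_mat n n" "upper_triangular_poly m A"
    and "stable_poly n m A \<Omega>"
  shows "hyperstable_poly n m A \<Omega>"
  unfolding hyperstable_poly_def
proof (intro ballI impI)
  fix y :: "quat vec"
  assume y: "y \<in> carrier_vec n" "y \<noteq> 0\<^sub>v n"
  then obtain k where k: "k < n" "y $ k \<noteq> 0" "\<And>l. k < l \<Longrightarrow> l < n \<Longrightarrow> y $ l = 0"
    by (rule last_nonzero_index) blast
  have "(\<Sum>i\<le>m. qform (unit_vec n k) (A i) y * \<mu> ^ i) \<noteq> 0" if "\<mu> \<in> \<Omega>" for \<mu>
  proof -
    have "qcnj 1 = 1" "qcnj 0 = 0"
      by (simp_all add: quat_eq_iff)
    then have "qcnj (unit_vec n k $ j) * x = (if j = k then x else 0)" if "j < n" for j x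
      using that k(1) by simp
    then have "(\<Sum>i\<le>m. qform (unit_vec n k) (A i) y * \<mu> ^ i)
        = (\<Sum>l<n. entry_map m A \<mu> k l (y $ l))"
      using sum_qform_eq_entry_maps[OF A(1) y(1), where z = "unit_vec n k"] k(1) by simp
    also have "\<dots> = entry_map m A \<mu> k k (y $ k)"
      using upper_triangular_row_sum[OF A k(1) k(1), of "\<lambda>l. y $ l"] k(3) by simp
    also have "\<dots> \<noteq> 0"
      using stable_imp_diagonal_injective[OF A assms(3) that k(1)] k(2) by blast
    finally show ?thesis .
  qed
  moreover have "unit_vec n k \<noteq> (0\<^sub>v n :: quat vec)"
    using k(1) by (metis index_unit_vec(1) index_zero_vec(1) zero_neq_one)
  ultimately show "\<exists>z\<in>carrier_vec n. z \<noteq> 0\<^sub>v n \<and>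
      (\<forall>\<mu>\<in>\<Omega>. (\<Sum>i\<le>m. qform z (A i) y * \<mu> ^ i) \<noteq> 0)"
    by (intro bexI[of _ "unit_vec n k"]) auto
qed

theorem theorem4p28:
  fixes n m :: nat and A :: "nat \<Rightarrow> quat mat" and \<Omega> :: "quat set"
  assumes "\<And>i. i < m \<Longrightarrow> A i \<in> carrier_mat n n"
    and "A m = 1\<^sub>m n"
    and "\<Omega> \<noteq> {}"
    and "upper_triangular_poly m A"
  shows "hyperstable_poly n m A \<Omega> \<longleftrightarrow> stable_poly n m A \<Omega>"
proof
  assume "hyperstable_poly n m A \<Omega>"
  then show "stable_poly n m A \<Omega>"
    unfolding hyperstable_poly_def stable_poly_def by blast
next
  have "A i \<in> carrier_mat n n" if "i \<le> m" for i
    using that assms(1,2) by (cases "i = m") auto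
  moreover assume "stable_poly n m A \<Omega>"
  ultimately show "hyperstable_poly n m A \<Omega>"
    using assms(4) stable_imp_hyperstable by blast
qed

end
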